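(* For every positive integer $m$, there exists a convex set $A\subseteq \mathbb{R}$ with $|A| = 2m$ and a non-zero element $d \in A-A$ such that $r_{A-A}(d) \geq m$.
   Context: A finite set $A=\{a_1<a_2<\dots<a_n\} \subset \mathbb{R}$ is called convex if its consecutive differences are strictly increasing, i.e. $a_i - a_{i-1} < a_{i+1}-a_i$ for all $2 \le i \le n-1$. The difference set is $A-A=\{a-b : a,b\in A\}$, and for $x\in\mathbb{R}$, $r_{A-A}(x) = |\{(a,b)\in A\times A : a-b=x\}|$. *)

theory Defs
  imports Complex_Main
begin

text \<open>
  The increasing enumeration of a finite set \<open>A\<close> is \<open>sorted_list_of_set A\<close>, indexed from \<open>0\<close>;
  the convexity condition on \<open>a_i\<close> for \<open>2 \<le> i \<le> n - 1\<close> becomes one on the middle index \<open>Suc i\<close>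
  with \<open>Suc (Suc i) < card A\<close>.
\<close>

definition convex_finite_set :: "real set \<Rightarrow> bool" where
  "convex_finite_set A \<longleftrightarrow> finite A \<and>
     (\<forall>i. Suc (Suc i) < card A \<longrightarrow>
        sorted_list_of_set A ! Suc i - sorted_list_of_set A ! i
          < sorted_list_of_set A ! Suc (Suc i) - sorted_list_of_set A ! Suc i)"

definition difference_set :: "real set \<Rightarrow> real set" where
  "difference_set A = {a - b | a b. a \<in> A \<and> b \<in> A}"

definition diff_rep_count :: "real set \<Rightarrow> real \<Rightarrow> nat" where
  "diff_rep_count A x = card {(a, b) \<in> A \<times> A. a - b = x}"

end

theory Submission imports Defs begin

text \<open>
  Take \<open>A = {- ln k | 1 \<le> k \<le> 2 m}\<close>. Since \<open>- ln\<close> is strictly convex, \<open>A\<close> is convex, and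
  \<open>- ln k - (- ln (2 k)) = ln 2\<close> for each of the \<open>m\<close> values \<open>k = 1, \<dots>, m\<close>.
\<close>

lemma sorted_list_of_strict_mono_image:
  fixes f :: "nat \<Rightarrow> 'a :: linorder"
  assumes "strict_mono_on {..<n} f"
  shows "sorted_list_of_set (f ` {..<n}) = map f [0..<n]"
proof -
  have "sorted_wrt (<) (map f [0..<n])"
    using assms by (auto simp: sorted_wrt_iff_nth_less strict_mono_on_def)
  then have "sorted_list_of_set (set (map f [0..<n])) = map f [0..<n]"
    unfolding strict_sorted_iff by (intro sorted_list_of_set.idem_if_sorted_distinct) auto
  then show ?thesis
    by (simp add: atLeast0LessThan)
qed

text \<open>A strictly increasing \<open>f\<close> lists its image in sorted order, so
  \<open>sorted_list_of_set\<close> can be replaced by \<open>f\<close> and convexity is checked on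
  indices.\<close>

lemma convex_finite_set_image:
  assumes mono: "strict_mono_on {..<n} f"
    and convex: "\<And>i. Suc (Suc i) < n \<Longrightarrow> f (Suc i) - f i < f (Suc (Suc i)) - f (Suc i)"
  shows "convex_finite_set (f ` {..<n})"
proof -
  have "card (f ` {..<n}) = n"
    using mono by (simp add: card_image strict_mono_on_imp_inj_on)
  then show ?thesis
    using convex by (simp add: convex_finite_set_def sorted_list_of_strict_mono_image[OF mono])
qed

text \<open>Exponentiating turns the claim into \<open>k * (k + 2) < (k + 1) * (k + 1)\<close>,
  where the two sides differ by 1.\<close>

lemma ln_concave_nat:
  fixes k :: nat
  assumes "k > 0"
  shows "ln (real (k + 2)) - ln (real (k + 1)) < ln (real (k + 1)) - ln (real k)"
proof -
  have "ln (real (k + 2) * real k) < ln (real (k + 1) * real (k + 1))"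
    using assms by (subst ln_less_cancel_iff) (auto simp: algebra_simps intro!: add_pos_nonneg)
  then show ?thesis
    using assms by (simp add: ln_mult)
qed

lemma convex_finite_set_neg_ln: "convex_finite_set ((\<lambda>k. - ln (real k)) ` {1..n})"
proof -
  \<comment> \<open>Since \<open>- ln\<close> is decreasing, the increasing enumeration runs through
    the arguments backwards, from \<open>n\<close> at index 0 down to 1 at index
    \<open>n - 1\<close>.\<close>
  let ?f = "\<lambda>i. - ln (real (n - i))"
  have "strict_mono_on {..<n} ?f"
    by (auto intro!: strict_mono_onI)
  moreover have "?f (Suc i) - ?f i < ?f (Suc (Suc i)) - ?f (Suc i)" if "Suc (Suc i) < n" for i
  proof -
    \<comment> \<open>The indices \<open>i\<close>, \<open>Suc i\<close>, \<open>Suc (Suc i)\<close>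
      carry the arguments \<open>k + 2\<close>, \<open>k + 1\<close>, \<open>k\<close>; positivity
      of \<open>k\<close> is exactly the index bound.\<close>
    define k where "k = n - Suc (Suc i)"
    have "k > 0" "n - Suc i = k + 1" "n - i = k + 2"
      using that by (auto simp: k_def)
    with ln_concave_nat[of k] show ?thesis
      by (simp flip: k_def)
  qed
  ultimately have "convex_finite_set (?f ` {..<n})"
    by (rule convex_finite_set_image)
  moreover have "(\<lambda>i. n - i) ` {..<n} = {1..n}"
  proof (intro equalityI subsetI)
    fix k assume "k \<in> {1..n}"
    then show "k \<in> (\<lambda>i. n - i) ` {..<n}"
      by (intro image_eqI[of _ _ "n - k"]) auto
  qed auto
  then have "?f ` {..<n} = (\<lambda>k. - ln (real k)) ` {1..n}"
    by (metis image_image)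
  ultimately show ?thesis
    by simp
qed

theorem theorem1:
  fixes m :: nat
  assumes "m > 0"
  shows "\<exists>A :: real set. convex_finite_set A \<and> card A = 2 * m \<and>
           (\<exists>d \<in> difference_set A. d \<noteq> 0 \<and> diff_rep_count A d \<ge> m)"
proof -
  define f :: "nat \<Rightarrow> real" where "f = (\<lambda>k. - ln (real k))"
  define A where "A = f ` {1..2 * m}"
  have inj: "inj_on f {1..2 * m}"
    by (auto simp: inj_on_def f_def)
  have diff: "f k - f (2 * k) = ln 2" if "k > 0" for k
    using that by (simp add: f_def ln_mult)
  let ?P = "{(a, b) \<in> A \<times> A. a - b = ln 2}"
  \<comment> \<open>For \<open>k \<le> m\<close> the argument \<open>2 * k\<close> is at most
    \<open>2 * m\<close>, so both components lie in \<open>A\<close>.\<close>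
  let ?g = "\<lambda>k. (f k, f (2 * k))"
  have sub: "?g ` {1..m} \<subseteq> ?P"
    using diff by (auto simp: A_def)
  have "inj_on f {1..m}"
    by (rule inj_on_subset[OF inj]) auto
  \<comment> \<open>The first component alone already determines \<open>k\<close>.\<close>
  then have "inj_on ?g {1..m}"
    by (intro inj_on_imageI2[of fst]) (simp add: comp_def)
  moreover have "finite ?P"
    by (rule finite_subset[of _ "A \<times> A"]) (auto simp: A_def)
  ultimately have "m \<le> diff_rep_count A (ln 2)"
    using card_inj_on_le[OF _ sub] by (simp add: diff_rep_count_def)
  moreover have "ln 2 \<in> difference_set A"
  proof -
    \<comment> \<open>The pair for \<open>k = 1\<close> is available because \<open>m > 0\<close>
      gives \<open>2 \<le> 2 * m\<close>.\<close>
    have "f 1 \<in> A" "f 2 \<in> A" "f 1 - f 2 = ln 2"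
      using assms diff[of 1] by (auto simp: A_def)
    then show ?thesis
      unfolding difference_set_def by (metis (mono_tags, lifting) mem_Collect_eq)
  qed
  moreover have "convex_finite_set A"
    unfolding A_def f_def by (rule convex_finite_set_neg_ln)
  moreover have "card A = 2 * m"
    using inj by (simp add: A_def card_image)
  ultimately show ?thesis
    by (intro exI[of _ A] conjI bexI[of _ "ln 2"]) auto
qed

end
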